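(* Let $h\in\mathbb R\setminus\{0\}$ and $x\in\mathbb C$. The function $y\mapsto \exp_h(x,y)$ on $\mathbb R$ is an eigenfunction of the operator $\delta_{y,h}$ with eigenvalue $x$, i.e. it is not identically zero and $$\delta_{y,h}\exp_h(x,y)=x\,\exp_h(x,y)\qquad\text{for all } y\in\mathbb R.$$
   Context: For $h\in\mathbb R\setminus\{0\}$, the deformed exponential function $\exp_h$ of two variables is $$\exp_h(x,y)=\bigl(hx+\sqrt{1+h^2x^2}\bigr)^{y/h}\qquad (x\in\mathbb C,\ y\in\mathbb R),$$ with the principal branches of the square root and of complex powers, $w^{\alpha}=\exp(\alpha\operatorname{Log} w)$ for $w\ne 0$. The central $h$-difference operator acting on a function of the variable $y$ is $$\delta_{y,h} f(y)=\frac{f(y+h)-f(y-h)}{2h}.$$ *)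

theory Defs
  imports "HOL-Analysis.Analysis"
begin

(* csqrt and the complex powr are the principal branches.  The base of the power
   is never 0, because (h x + s) (s - h x) = 1 for s = csqrt (1 + h^2 x^2), so the
   convention 0 powr a = 0 plays no role. *)
definition deformed_exp :: "real \<Rightarrow> complex \<Rightarrow> real \<Rightarrow> complex" where
  "deformed_exp h x y =
     (of_real h * x + csqrt (1 + (of_real h)\<^sup>2 * x\<^sup>2)) powr of_real (y / h)"

definition central_diff :: "real \<Rightarrow> (real \<Rightarrow> complex) \<Rightarrow> real \<Rightarrow> complex" where
  "central_diff h f y = (f (y + h) - f (y - h)) / (2 * of_real h)"

definition eigenfunction ::
  "((real \<Rightarrow> complex) \<Rightarrow> real \<Rightarrow> complex) \<Rightarrow> complex \<Rightarrow> (real \<Rightarrow> complex) \<Rightarrow> bool" where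
  "eigenfunction T ev f \<longleftrightarrow> (\<exists>y. f y \<noteq> 0) \<and> (\<forall>y. T f y = ev * f y)"

end

theory Submission
  imports Defs
begin

text \<open>
  Write \<open>w = h x + s\<close> with \<open>s = \<surd>(1 + h\<^sup>2 x\<^sup>2)\<close>. The shift \<open>y \<mapsto> y \<plusminus> h\<close> moves the
  exponent \<open>y / h\<close> by \<open>\<plusminus>1\<close>, and for a fixed branch of the logarithm this multiplies the
  power by \<open>w\<close> or \<open>1 / w\<close>, whatever the base \<open>w \<noteq> 0\<close> is. So every function
  \<open>y \<mapsto> w powr (y / h)\<close> is an eigenfunction of the central difference, with eigenvalue
  \<open>(w - 1 / w) / (2 h)\<close>. The base of the deformed exponential is the solution of
  \<open>w - 1 / w = 2 h x\<close> singled out by the principal square root: \<open>(s + h x) (s - h x) = 1\<close>,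
  so \<open>1 / w = s - h x\<close>.
\<close>

lemma central_diff_powr:
  fixes w :: complex
  assumes "h \<noteq> 0" and "w \<noteq> 0"
  shows "central_diff h (\<lambda>y. w powr of_real (y / h)) y =
           (w - inverse w) / (2 * of_real h) * w powr of_real (y / h)"
proof -
  have "w powr of_real ((y + h) / h) = w powr of_real (y / h) * w"
    using assms by (simp add: add_divide_distrib powr_add)
  moreover have "w powr of_real ((y - h) / h) = w powr of_real (y / h) * inverse w"
    using assms by (simp add: diff_divide_distrib powr_diff inverse_eq_divide)
  ultimately show ?thesis
    unfolding central_diff_def by (simp only: right_diff_distrib[symmetric]) simp
qed

lemma add_csqrt_mult_conjugate:
  "(z + csqrt (1 + z\<^sup>2)) * (csqrt (1 + z\<^sup>2) - z) = 1"
proof -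
  have "(z + csqrt (1 + z\<^sup>2)) * (csqrt (1 + z\<^sup>2) - z) = (csqrt (1 + z\<^sup>2))\<^sup>2 - z\<^sup>2"
    by (simp add: algebra_simps power2_eq_square)
  then show ?thesis by simp
qed

theorem theorem4p3:
  fixes h :: real and x :: complex
  assumes "h \<noteq> 0"
  shows "eigenfunction (central_diff h) x (\<lambda>y. deformed_exp h x y)"
proof -
  define z where "z = of_real h * x"
  define w where "w = z + csqrt (1 + z\<^sup>2)"
  have exp_eq: "deformed_exp h x = (\<lambda>y. w powr of_real (y / h))"
    by (simp add: fun_eq_iff deformed_exp_def w_def z_def power_mult_distrib)
  have w_mult: "w * (csqrt (1 + z\<^sup>2) - z) = 1"
    unfolding w_def by (rule add_csqrt_mult_conjugate)
  then have w_nz: "w \<noteq> 0" by auto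
  have "inverse w = csqrt (1 + z\<^sup>2) - z"
    using w_mult by (rule inverse_unique)
  then have "w - inverse w = 2 * of_real h * x"
    by (simp add: w_def z_def)
  then have eigenvalue: "(w - inverse w) / (2 * of_real h) = x"
    using assms by simp
  have "w powr of_real (0 / h) \<noteq> 0"
    using w_nz by simp
  then show ?thesis
    unfolding eigenfunction_def exp_eq
    using central_diff_powr[OF assms w_nz] eigenvalue by auto
qed

end
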